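(* Let $N$ be a positive integer, let $T>0$ and, for $k\in[N]$, let $x^k_\cdot,y^k_\cdot:[0,T]\to\mathbb R_{\geqslant0}$ be $C^1$ functions. Suppose that there exist real numbers $c_1>c_2\geqslant0$ and $C_0,M_2,M_3\geqslant0$ such that for all $t\in[0,T]$, $k\in[N]$ and $r\in[0,1)$, $$\sum_{k=1}^Nr^kx^k_0\leqslant\frac{C_0}{N^2(1-r)^3},$$ $$\frac{dx^k_t}{dt}\leqslant-c_1y^k_t+c_2y^{k+1}_t\mathbf 1_{k<N}+M_2\,k\,x^{k+1}_t\mathbf 1_{k<N}+M_3\frac{k^2}{N^2}.$$ Then there exist $T_*>0$ and $M>0$, depending only on $c_1,c_2,C_0,M_2,M_3$, such that for all $t\in[0,T_*\wedge T)$ and all $k\in[N]$, $$x^k_t\leqslant\frac{Me^{Mk}}{(T_*-t)^3N^2}.$$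
   Context: $[N]=\{1,\dots,N\}$; $a\wedge b=\min(a,b)$. $\mathbf 1_{k<N}$ equals $1$ if $k<N$ and $0$ otherwise; terms multiplied by $\mathbf 1_{k<N}$ are absent when $k=N$. "Depending only on" means in particular that $T_*$ and $M$ do not depend on $N$, $k$, $t$ or $T$. *)

theory Defs
  imports "HOL-Analysis.Analysis"
begin

(* Derivatives are taken within S, so at the endpoints of a closed interval they are one-sided;
   the library's C1_differentiable_on would require two-sided derivatives there. *)
definition C1_within :: "(real \<Rightarrow> real) \<Rightarrow> real set \<Rightarrow> bool" where
  "C1_within f S \<longleftrightarrow> f differentiable_on S \<and>
     continuous_on S (\<lambda>t. vector_derivative f (at t within S))"

end

theory Submission
  imports Defs
begin

text \<open>
  The bound follows from a differential inequality for the generating function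
  \<open>F t r = (\<Sum>k=1..N. r ^ k * x k t)\<close>. Two things happen after multiplying the \<open>k\<close>-th
  inequality by \<open>r ^ k\<close> and summing.

  The contribution of \<open>y\<close> is \<open>\<Sum>k. (c2 * r ^ (k - 1) - c1 * r ^ k) * y k\<close>, up to a nonpositive
  term, and this is nonpositive as soon as \<open>c2 \<le> c1 * r\<close>. Since \<open>c2 < c1\<close>, there is room for such
  an \<open>r\<close> below 1.

  The contribution of \<open>M2 * k * x (k + 1)\<close> is at most \<open>M2\<close> times the derivative of \<open>F\<close> in \<open>r\<close>.
  This is a transport term: it is cancelled by following \<open>F\<close> along the characteristic
  \<open>r s = R - M2 * s\<close>. On this line only the \<open>M3\<close> term is left, whose weighted sum is at most
  \<open>2 * M3 / (N\<^sup>2 * (1 - R) ^ 3)\<close>, uniformly in \<open>N\<close>. Hence \<open>F t (R - M2 * t) \<le> K / N\<^sup>2\<close> as long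
  as the characteristic stays above \<open>c2 / c1\<close>, which is a time that depends only on the
  constants (\<open>generating_function_along_characteristic\<close>).

  As all summands are nonnegative, each \<open>x k t\<close> is at most \<open>(R - M2 * t) powr (- k) * K / N\<^sup>2\<close>, and
  this is exponential in \<open>k\<close> because the characteristic also stays away from 0. This bound does
  not blow up in time, and it implies one with the factor \<open>1 / (Tstar - t) ^ 3\<close>, which is at least
  \<open>1 / Tstar ^ 3\<close>.
\<close>

text \<open>
  The partial sums have a closed form, which is how the induction goes through; the term it
  subtracts is \<open>r ^ (n + 1)\<close> times a sum of nonnegative terms.
\<close>
lemma sum_square_times_power_le:
  fixes r :: real
  assumes "0 \<le> r" "r < 1"
  shows "(\<Sum>k=1..n. real k ^ 2 * r ^ k) \<le> 2 / (1 - r) ^ 3"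
proof -
  have closed_form: "(\<Sum>k=1..n. real k ^ 2 * r ^ k) * (1 - r) ^ 3
      = r * (1 + r) - r ^ (n + 1) * ((real n * (1 - r) + 1) ^ 2 + r)"
  proof (induction n)
    case 0
    then show ?case by (simp add: algebra_simps)
  next
    case (Suc n)
    then show ?case
      by (simp add: algebra_simps power2_eq_square power3_eq_cube)
  qed
  have "r * (1 + r) \<le> 1 * 2"
    using assms by (intro mult_mono) auto
  moreover have "0 \<le> r ^ (n + 1) * ((real n * (1 - r) + 1) ^ 2 + r)"
    using assms by simp
  ultimately have "(\<Sum>k=1..n. real k ^ 2 * r ^ k) * (1 - r) ^ 3 \<le> 2"
    unfolding closed_form by linarith
  then show ?thesis
    using assms by (simp add: pos_le_divide_eq)
qed

lemma sum_shift_index: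
  fixes f g :: "nat \<Rightarrow> 'a::comm_ring_1"
  assumes "N \<ge> 1"
  shows "(\<Sum>k=1..N. f k * (g (k + 1) * of_bool (k < N))) = (\<Sum>k=1..N. f (k - 1) * g k) - f 0 * g 1"
proof -
  obtain n where N: "N = Suc n" using assms by (cases N) auto
  have "(\<Sum>k=1..N. f k * (g (k + 1) * of_bool (k < N))) = (\<Sum>k=1..n. f k * g (k + 1))"
    unfolding N by (simp add: sum.cl_ivl_Suc)
  also have "\<dots> = (\<Sum>k=1..N. f (k - 1) * g k) - f 0 * g 1"
    unfolding N by (induction n) simp_all
  finally show ?thesis .
qed

text \<open>
  The differential inequality at a fixed time. Here \<open>d k\<close> stands for the derivative of \<open>x k\<close>, and
  the subtracted sum is what differentiating \<open>r ^ k\<close> contributes when \<open>r\<close> decreases at speed \<open>M2\<close>;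
  it dominates the \<open>M2\<close> term because \<open>k - 1 \<le> k\<close> after an index shift.
\<close>
lemma weighted_sum_along_characteristic_le:
  fixes r c1 c2 M2 M3 :: real and d x y :: "nat \<Rightarrow> real"
  assumes "N \<ge> 1" and r: "0 \<le> r" "r < 1" and c: "0 \<le> c2" "c2 \<le> c1 * r" and "M2 \<ge> 0" "M3 \<ge> 0"
    and x: "\<And>k. k \<in> {1..N} \<Longrightarrow> x k \<ge> 0" and y: "\<And>k. k \<in> {1..N} \<Longrightarrow> y k \<ge> 0"
    and d: "\<And>k. k \<in> {1..N} \<Longrightarrow> d k \<le> - c1 * y k + c2 * y (k + 1) * of_bool (k < N)
      + M2 * real k * x (k + 1) * of_bool (k < N) + M3 * (real k ^ 2 / real N ^ 2)"
  shows "(\<Sum>k=1..N. r ^ k * d k) - M2 * (\<Sum>k=1..N. real k * r ^ (k - 1) * x k)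
    \<le> 2 * M3 / (real N ^ 2 * (1 - r) ^ 3)"
proof -
  have one_in: "1 \<in> {1..N}" using \<open>N \<ge> 1\<close> by simp
  have "(\<Sum>k=1..N. r ^ k * d k) \<le> (\<Sum>k=1..N. r ^ k * (- c1 * y k + c2 * y (k + 1) * of_bool (k < N)
      + M2 * real k * x (k + 1) * of_bool (k < N) + M3 * (real k ^ 2 / real N ^ 2)))"
    using d r by (intro sum_mono mult_left_mono) auto
  also have "\<dots> = - (\<Sum>k=1..N. c1 * r ^ k * y k)
      + (\<Sum>k=1..N. c2 * r ^ k * (y (k + 1) * of_bool (k < N)))
      + M2 * (\<Sum>k=1..N. real k * r ^ k * (x (k + 1) * of_bool (k < N)))
      + M3 / real N ^ 2 * (\<Sum>k=1..N. real k ^ 2 * r ^ k)"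
    unfolding sum_distrib_left sum_negf [symmetric] sum.distrib [symmetric]
    by (intro sum.cong) (auto simp: algebra_simps)
  finally have split: "(\<Sum>k=1..N. r ^ k * d k) \<le> \<dots>" .
  have "(\<Sum>k=1..N. c2 * r ^ k * (y (k + 1) * of_bool (k < N)))
      \<le> (\<Sum>k=1..N. c2 * r ^ (k - 1) * y k)"
    using sum_shift_index [OF \<open>N \<ge> 1\<close>, of "\<lambda>k. c2 * r ^ k" y] c y [OF one_in] by simp
  also have "\<dots> \<le> (\<Sum>k=1..N. c1 * r ^ k * y k)"
  proof (intro sum_mono mult_right_mono)
    fix k assume "k \<in> {1..N}"
    then have "r ^ k = r * r ^ (k - 1)" by (cases k) auto
    then show "c2 * r ^ (k - 1) \<le> c1 * r ^ k"
      using mult_right_mono [OF c(2), of "r ^ (k - 1)"] r by (simp add: mult.assoc)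
  qed (use y in auto)
  finally have y_part: "(\<Sum>k=1..N. c2 * r ^ k * (y (k + 1) * of_bool (k < N)))
      \<le> (\<Sum>k=1..N. c1 * r ^ k * y k)" .
  have "(\<Sum>k=1..N. real k * r ^ k * (x (k + 1) * of_bool (k < N)))
      = (\<Sum>k=1..N. real (k - 1) * r ^ (k - 1) * x k)"
    using sum_shift_index [OF \<open>N \<ge> 1\<close>, of "\<lambda>k. real k * r ^ k" x] by simp
  also have "\<dots> \<le> (\<Sum>k=1..N. real k * r ^ (k - 1) * x k)"
    using x r by (intro sum_mono mult_right_mono) auto
  finally have x_part: "M2 * (\<Sum>k=1..N. real k * r ^ k * (x (k + 1) * of_bool (k < N)))
      \<le> M2 * (\<Sum>k=1..N. real k * r ^ (k - 1) * x k)"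
    using \<open>M2 \<ge> 0\<close> by (rule mult_left_mono)
  have "M3 / real N ^ 2 * (\<Sum>k=1..N. real k ^ 2 * r ^ k) \<le> M3 / real N ^ 2 * (2 / (1 - r) ^ 3)"
    using \<open>M3 \<ge> 0\<close> r by (intro mult_left_mono sum_square_times_power_le) auto
  then have "M3 / real N ^ 2 * (\<Sum>k=1..N. real k ^ 2 * r ^ k) \<le> 2 * M3 / (real N ^ 2 * (1 - r) ^ 3)"
    by (simp add: mult.commute)
  with split y_part x_part show ?thesis by linarith
qed

lemma C1_within_has_real_derivative:
  assumes "C1_within f {a..b}" "t \<in> {a..b}"
  shows "(f has_real_derivative vector_derivative f (at t within {a..b})) (at t within {a..b})"
  using assms unfolding C1_within_def differentiable_on_def has_real_derivative_iff_has_vector_derivative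
  by (metis vector_derivative_works)

text \<open>
  The generating function grows along the characteristic at a rate that contains
  \<open>1 / (1 - (R - M2 * s)) ^ 3\<close>. This is largest at \<open>s = 0\<close>, so the constant \<open>1 / (1 - R) ^ 3\<close> can
  replace it, and integration costs a factor \<open>t\<close>.
\<close>
lemma generating_function_along_characteristic:
  fixes c1 c2 C0 M2 M3 R T t :: real and x y :: "nat \<Rightarrow> real \<Rightarrow> real"
  assumes "N \<ge> 1" and t: "t \<in> {0..T}"
    and const: "c1 > 0" "c2 \<ge> 0" "M2 \<ge> 0" "M3 \<ge> 0"
    and R: "R < 1" "0 \<le> R - M2 * t" "c2 \<le> c1 * (R - M2 * t)"
    and C1: "\<And>k. k \<in> {1..N} \<Longrightarrow> C1_within (x k) {0..T}"
    and x: "\<And>k s. k \<in> {1..N} \<Longrightarrow> s \<in> {0..T} \<Longrightarrow> x k s \<ge> 0"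
    and y: "\<And>k s. k \<in> {1..N} \<Longrightarrow> s \<in> {0..T} \<Longrightarrow> y k s \<ge> 0"
    and init: "(\<Sum>k=1..N. R ^ k * x k 0) \<le> C0 / (real N ^ 2 * (1 - R) ^ 3)"
    and d: "\<And>k s. k \<in> {1..N} \<Longrightarrow> s \<in> {0..T} \<Longrightarrow> vector_derivative (x k) (at s within {0..T})
         \<le> - c1 * y k s + c2 * y (k + 1) s * of_bool (k < N)
           + M2 * real k * x (k + 1) s * of_bool (k < N) + M3 * (real k ^ 2 / real N ^ 2)"
  shows "(\<Sum>k=1..N. (R - M2 * t) ^ k * x k t) \<le> (C0 + 2 * M3 * t) / (real N ^ 2 * (1 - R) ^ 3)"
proof -
  define r where "r s = R - M2 * s" for s
  define x' where "x' k s = vector_derivative (x k) (at s within {0..T})" for k s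
  define B where "B = 2 * M3 / (real N ^ 2 * (1 - R) ^ 3)"
  define G where "G s = (\<Sum>k=1..N. r s ^ k * x k s) - B * s" for s
  define G' where "G' s = (\<Sum>k=1..N. r s ^ k * x' k s)
      - M2 * (\<Sum>k=1..N. real k * r s ^ (k - 1) * x k s) - B" for s
  have deriv: "(G has_real_derivative G' s) (at s within {0..T})" if "s \<in> {0..T}" for s
  proof -
    have [derivative_intros]: "(x k has_real_derivative x' k s) (at s within {0..T})"
      if "k \<in> {1..N}" for k
      unfolding x'_def using C1_within_has_real_derivative C1 \<open>s \<in> {0..T}\<close> that by blast
    show ?thesis
      unfolding G_def G'_def r_def
      by (auto intro!: derivative_eq_intros simp: sum_distrib_left sum_subtractf [symmetric]
          intro!: sum.cong simp: algebra_simps)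
  qed
  have nonpos: "G' s \<le> 0" if "s \<in> {0..t}" for s
  proof -
    have s: "s \<in> {0..T}" using that t by auto
    have "M2 * s \<le> M2 * t" "0 \<le> M2 * s" using that \<open>M2 \<ge> 0\<close> by (auto intro: mult_left_mono)
    then have r: "R - M2 * t \<le> r s" "r s \<le> R" unfolding r_def by linarith+
    then have r': "0 \<le> r s" "r s < 1" using R by linarith+
    have "c2 \<le> c1 * r s"
      using R(3) mult_left_mono [OF r(1), of c1] \<open>c1 > 0\<close> by linarith
    then have "(\<Sum>k=1..N. r s ^ k * x' k s) - M2 * (\<Sum>k=1..N. real k * r s ^ (k - 1) * x k s)
        \<le> 2 * M3 / (real N ^ 2 * (1 - r s) ^ 3)"
      using x y s d [folded x'_def] const r' \<open>N \<ge> 1\<close>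
      by (intro weighted_sum_along_characteristic_le [where y = "\<lambda>k. y k s" and ?c1.0 = c1 and ?c2.0 = c2])
         auto
    also have "\<dots> \<le> B"
      unfolding B_def using r r' R const \<open>N \<ge> 1\<close>
      by (intro divide_left_mono mult_left_mono power_mono mult_pos_pos) auto
    finally show ?thesis unfolding G'_def by linarith
  qed
  have "G t \<le> G 0"
  proof (rule DERIV_nonpos_imp_decreasing_open [where f = G])
    show "continuous_on {0..t} G"
      using DERIV_continuous_on [OF deriv] t by (auto intro: continuous_on_subset)
    fix s assume that: "0 < s" "s < t"
    show "\<exists>D. (G has_real_derivative D) (at s) \<and> D \<le> 0"
    proof (intro exI conjI)
      have "s \<in> interior {0..T}" using that t by auto
      then have "at s within {0..T} = at s" by (rule at_within_interior)
      moreover have "s \<in> {0..T}" using that t by auto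
      ultimately show "(G has_real_derivative G' s) (at s)"
        using deriv by metis
      show "G' s \<le> 0" using that by (intro nonpos) auto
    qed
  qed (use t in auto)
  then have "(\<Sum>k=1..N. r t ^ k * x k t) \<le> (\<Sum>k=1..N. R ^ k * x k 0) + B * t"
    unfolding G_def by (simp add: r_def)
  also have "\<dots> \<le> C0 / (real N ^ 2 * (1 - R) ^ 3) + B * t"
    using init by simp
  also have "\<dots> = (C0 + 2 * M3 * t) / (real N ^ 2 * (1 - R) ^ 3)"
    unfolding B_def by (simp add: add_divide_distrib)
  finally show ?thesis unfolding r_def .
qed

theorem proposition6:
  fixes c1 c2 C0 M2 M3 :: real
  assumes "c1 > c2" and "c2 \<ge> 0" and "C0 \<ge> 0" and "M2 \<ge> 0" and "M3 \<ge> 0"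
  shows "\<exists>Tstar>0. \<exists>M>0.
    \<forall>(N::nat) (T::real) (x :: nat \<Rightarrow> real \<Rightarrow> real) (y :: nat \<Rightarrow> real \<Rightarrow> real).
      N \<ge> 1 \<longrightarrow> T > 0 \<longrightarrow>
      (\<forall>k\<in>{1..N}. C1_within (x k) {0..T} \<and> C1_within (y k) {0..T}) \<longrightarrow>
      (\<forall>k\<in>{1..N}. \<forall>t\<in>{0..T}. x k t \<ge> 0 \<and> y k t \<ge> 0) \<longrightarrow>
      (\<forall>r\<in>{0..<1}. (\<Sum>k=1..N. r ^ k * x k 0) \<le> C0 / (real N ^ 2 * (1 - r) ^ 3)) \<longrightarrow>
      (\<forall>t\<in>{0..T}. \<forall>k\<in>{1..N}.
         vector_derivative (x k) (at t within {0..T})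
           \<le> - c1 * y k t + c2 * y (k + 1) t * of_bool (k < N)
             + M2 * real k * x (k + 1) t * of_bool (k < N)
             + M3 * (real k ^ 2 / real N ^ 2)) \<longrightarrow>
      (\<forall>t\<in>{0..<min Tstar T}. \<forall>k\<in>{1..N}.
         x k t \<le> M * exp (M * real k) / ((Tstar - t) ^ 3 * real N ^ 2))"
proof -
  have "c1 > 0" using assms by linarith
  define a where "a = c2 / c1"
  have a: "0 \<le> a" "a < 1" using assms \<open>c1 > 0\<close> by (auto simp: a_def)
  \<comment> \<open>The characteristic runs from \<open>R\<close> down to at least \<open>\<rho>\<close>, with \<open>c2 / c1 < \<rho> < R < 1\<close> and
    \<open>\<rho> > 0\<close> even if \<open>c2 = 0\<close>; dividing by \<open>M2 + 1\<close> covers \<open>M2 = 0\<close>.\<close>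
  define \<rho> where "\<rho> = (1 + a) / 2"
  define R where "R = (1 + \<rho>) / 2"
  define Tstar where "Tstar = (R - \<rho>) / (M2 + 1)"
  define K where "K = (C0 + 2 * M3 * Tstar) / (1 - R) ^ 3"
  define M where "M = 1 + K * Tstar ^ 3 + ln (1 / \<rho>)"
  have \<rho>: "0 < \<rho>" "a \<le> \<rho>" "\<rho> < 1" using a by (auto simp: \<rho>_def)
  have R: "\<rho> < R" "R < 1" using \<rho> by (auto simp: R_def)
  have "Tstar > 0" using R assms by (simp add: Tstar_def)
  have "K \<ge> 0" using R assms \<open>Tstar > 0\<close> by (simp add: K_def)
  have M: "M > 0" "K * Tstar ^ 3 \<le> M" "ln (1 / \<rho>) \<le> M"
  proof -
    have "0 \<le> K * Tstar ^ 3" using \<open>K \<ge> 0\<close> \<open>Tstar > 0\<close> by simp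
    moreover have "0 \<le> ln (1 / \<rho>)" using \<rho> by (intro ln_ge_zero) simp
    ultimately show "M > 0" "K * Tstar ^ 3 \<le> M" "ln (1 / \<rho>) \<le> M"
      unfolding M_def by linarith+
  qed
  show ?thesis
  proof (rule exI [of _ Tstar], rule conjI [OF \<open>Tstar > 0\<close>],
      rule exI [of _ M], rule conjI [OF M(1)], intro allI impI ballI)
    fix N k :: nat and T t :: real and x y :: "nat \<Rightarrow> real \<Rightarrow> real"
    assume "N \<ge> 1"
      and C1: "\<forall>k\<in>{1..N}. C1_within (x k) {0..T} \<and> C1_within (y k) {0..T}"
      and nonneg: "\<forall>k\<in>{1..N}. \<forall>t\<in>{0..T}. x k t \<ge> 0 \<and> y k t \<ge> 0"
      and init: "\<forall>r\<in>{0..<1}. (\<Sum>k=1..N. r ^ k * x k 0) \<le> C0 / (real N ^ 2 * (1 - r) ^ 3)"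
      and d: "\<forall>t\<in>{0..T}. \<forall>k\<in>{1..N}.
         vector_derivative (x k) (at t within {0..T})
           \<le> - c1 * y k t + c2 * y (k + 1) t * of_bool (k < N)
             + M2 * real k * x (k + 1) t * of_bool (k < N)
             + M3 * (real k ^ 2 / real N ^ 2)"
      and t: "t \<in> {0..<min Tstar T}" and k: "k \<in> {1..N}"
    have t': "t \<in> {0..T}" "0 \<le> t" "t < Tstar" using t by auto
    have "M2 * t \<le> (M2 + 1) * Tstar" using t' assms by (intro mult_mono) auto
    also have "\<dots> = R - \<rho>" using assms by (simp add: Tstar_def)
    finally have r: "\<rho> \<le> R - M2 * t" by linarith
    have "c2 = c1 * a" using \<open>c1 > 0\<close> by (simp add: a_def)
    also have "\<dots> \<le> c1 * (R - M2 * t)" using r \<rho> \<open>c1 > 0\<close> by (intro mult_left_mono) auto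
    finally have c: "c2 \<le> c1 * (R - M2 * t)" .
    have x_nonneg: "x j t \<ge> 0" if "j \<in> {1..N}" for j using nonneg that t' by blast
    have "\<rho> ^ k * x k t \<le> (R - M2 * t) ^ k * x k t"
      using r \<rho> x_nonneg [OF k] by (intro mult_right_mono power_mono) auto
    also have "\<dots> \<le> (\<Sum>j=1..N. (R - M2 * t) ^ j * x j t)"
      using k r \<rho> x_nonneg by (intro member_le_sum) auto
    also have "\<dots> \<le> (C0 + 2 * M3 * t) / (real N ^ 2 * (1 - R) ^ 3)"
      using C1 nonneg d init t' r c R \<rho> \<open>N \<ge> 1\<close> \<open>c1 > 0\<close> assms
      by (intro generating_function_along_characteristic [where y = y and ?c1.0 = c1 and ?c2.0 = c2 and T = T])
         auto
    also have "\<dots> \<le> (C0 + 2 * M3 * Tstar) / (real N ^ 2 * (1 - R) ^ 3)"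
      using t' assms R \<open>N \<ge> 1\<close> by (intro divide_right_mono add_left_mono mult_left_mono) auto
    also have "\<dots> = K / real N ^ 2"
      by (simp add: K_def mult.commute)
    finally have "x k t * \<rho> ^ k \<le> K / real N ^ 2"
      by (simp add: mult.commute)
    then have "x k t \<le> K / real N ^ 2 / \<rho> ^ k"
      using \<rho> by (subst pos_le_divide_eq) auto
    also have "\<dots> = K / real N ^ 2 * (1 / \<rho>) ^ k"
      by (simp add: power_one_over)
    also have "(1 / \<rho>) ^ k = exp (real k * ln (1 / \<rho>))"
      using \<rho> by (simp add: exp_of_nat_mult)
    also have "K / real N ^ 2 * \<dots> \<le> K / real N ^ 2 * exp (M * real k)"
      using mult_left_mono [OF M(3), of "real k"] \<open>K \<ge> 0\<close>
      by (intro mult_left_mono) (auto simp: mult.commute)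
    also have "\<dots> \<le> M / ((Tstar - t) ^ 3 * real N ^ 2) * exp (M * real k)"
    proof (rule mult_right_mono)
      have "K * (Tstar - t) ^ 3 \<le> K * Tstar ^ 3"
        using t' \<open>K \<ge> 0\<close> by (intro mult_left_mono power_mono) auto
      then have "K \<le> M / (Tstar - t) ^ 3"
        using M t' by (simp add: pos_le_divide_eq)
      then show "K / real N ^ 2 \<le> M / ((Tstar - t) ^ 3 * real N ^ 2)"
        using divide_right_mono [of K "M / (Tstar - t) ^ 3" "real N ^ 2"] by simp
    qed simp
    finally show "x k t \<le> M * exp (M * real k) / ((Tstar - t) ^ 3 * real N ^ 2)"
      by simp
  qed
qed

end
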